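(* Let $P_1,P_2$ be processes each satisfying \texttt{positive bid-ask spread}, \texttt{price-time priority} and \texttt{conservation}. Then for every structured order book $\mathcal I$ and every natural number $k$, if $\mathsf{Iterated}(P_1,\mathcal I,k)=(B_1,A_1,M_1)$ and $\mathsf{Iterated}(P_2,\mathcal I,k)=(B_2,A_2,M_2)$, then $(B_1,A_1,\mathcal C(M_1))=(B_2,A_2,\mathcal C(M_2))$.
   Context: An order is a 4-tuple $\omega=(\mathsf{id}(\omega),\mathsf{timestamp}(\omega),\mathsf{qty}(\omega),\mathsf{price}(\omega))$ of natural numbers with $\mathsf{qty}(\omega)>0$; $\mathsf{ids}(S)$ is the set of ids of orders in $S$. An order-domain is a pair $(B,A)$ of finite sets of orders ($B$ = bids, $A$ = asks); it is admissible if all orders in $B\cup A$ have pairwise distinct ids and pairwise distinct timestamps. A bid $b$ and ask $a$ are tradable if $\mathsf{price}(b)\ge\mathsf{price}(a)$; $(B,A)$ is matchable if some $b\in B$, $a\in A$ are tradable. Competitiveness: bid $b_1\succ b_2$ iff $\mathsf{price}(b_1)>\mathsf{price}(b_2)$, or prices equal and $\mathsf{timestamp}(b_1)<\mathsf{timestamp}(b_2)$; ask $a_1\succ a_2$ iff $\mathsf{price}(a_1)<\mathsf{price}(a_2)$, or prices equal and $\mathsf{timestamp}(a_1)<\mathsf{timestamp}(a_2)$. A transaction is a triple $t=(\mathsf{id_{bid}}(t),\mathsf{id_{ask}}(t),\mathsf{qty}(t))$ of natural numbers with $\mathsf{qty}(t)>0$. It is valid w.r.t. $(B,A)$ if there are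 $b\in B$, $a\in A$ with $\mathsf{id_{bid}}(t)=\mathsf{id}(b)$, $\mathsf{id_{ask}}(t)=\mathsf{id}(a)$, $b,a$ tradable, and $\mathsf{qty}(t)\le\min(\mathsf{qty}(b),\mathsf{qty}(a))$. For a finite set of transactions $T$, $\mathsf{Qty}(T,id)$ is the sum of quantities of transactions in $T$ whose bid id (for a bid) resp. ask id (for an ask) equals $id$; $\mathsf{ids_{bid}}(T),\mathsf{ids_{ask}}(T)$ are the sets of bid/ask ids occurring in $T$. A matching over an admissible $(B,A)$ is a set $M$ of transactions valid w.r.t. $(B,A)$ with $\mathsf{Qty}(M,\mathsf{id}(\omega))\le\mathsf{qty}(\omega)$ for all $\omega\in B\cup A$. The canonical form $\mathcal C(M)$ is the set of transactions containing, for each bid id/ask id pair with positive total quantity in $M$, exactly one transaction between them whose quantity equals that total (and nothing else). $\mathsf{Bids}(M,B)$ is the set of bids of $B$ occurring in $M$ with quantity replaced by $\mathsf{Qty}(M,\mathsf{id}(b))$; $\mathsf{Asks}(M,A)$ likewise. Sets of orders are viewed as multisets where each order (quantity field suppressed) has multiplicity equal to its quantity; $S_1-S_2$ is multiset difference. An instruction is a pair $(\Delta,\omega)$ with command $\Delta\in\{\mathsf{Buy},\mathsf{Sell},\mathsf{Del}\}$ and an order $\omega$. $\mathsf{Absorb}(B,A,(\mathsf{Del},\omega))=(\{b\in B:\mathsf{id}(b)\ne\mathsf{id}(\omega)\},\{a\in A:\mathsf{id}(a)\ne\mathsf{id}(\omega)\})$, $\mathsf{Absorb}(B,A,(\mathsf{Buy},\beta))=(B\cup\{\beta\},A)$,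 $\mathsf{Absorb}(B,A,(\mathsf{Sell},\alpha))=(B,A\cup\{\alpha\})$. $((B,A),\tau)$ is a legal-input if $(B,A)$ is not matchable and $\mathsf{Absorb}(B,A,\tau)$ is admissible. A process is a function $P:(B,A,\tau)\mapsto(\hat B,\hat A,M)$. For every legal-input $((B,A),\tau)$ with $P(B,A,\tau)=(\hat B,\hat A,M)$ and $(B',A')=\mathsf{Absorb}(B,A,\tau)$, $P$ satisfies: \texttt{positive bid-ask spread} if $(\hat B,\hat A)$ is not matchable; \texttt{price-time priority} if for all $a,a'\in A'$ with $a\succ a'$ and $\mathsf{id}(a')\in\mathsf{ids_{ask}}(M)$ we have $\mathsf{Qty}(M,\mathsf{id}(a))=\mathsf{qty}(a)$, and for all $b,b'\in B'$ with $b\succ b'$ and $\mathsf{id}(b')\in\mathsf{ids_{bid}}(M)$ we have $\mathsf{Qty}(M,\mathsf{id}(b))=\mathsf{qty}(b)$; \texttt{conservation} if $M$ is a matching over $(B',A')$, $\hat B=B'-\mathsf{Bids}(M,B')$ and $\hat A=A'-\mathsf{Asks}(M,A')$. A process satisfies a property if it does so for all legal-inputs. An order book is a list $\mathcal I=[(\Delta_0,\omega_0),\dots,(\Delta_n,\omega_n)]$ of instructions. It is structured if (i) $\mathsf{timestamp}(\omega_i)<\mathsf{timestamp}(\omega_{i+1})$ for all $0\le i<n$, and (ii) for every $0\le i\le n$, at least one holds: $\Delta_i=\mathsf{Del}$; or $\mathsf{id}(\omega_i)\notin\mathsf{ids}\{\omega_0,\dots,\omega_{i-1}\}$; or ($i\ge1$,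 $\mathsf{id}(\omega_i)=\mathsf{id}(\omega_{i-1})$ and $\Delta_{i-1}=\mathsf{Del}$). $\mathsf{Iterated}(P,\mathcal I,k)$ is defined by: $\mathsf{Iterated}(P,\mathcal I,0)=(\emptyset,\emptyset,\emptyset)$; for $1\le k\le n+1$, if $\mathsf{Iterated}(P,\mathcal I,k-1)=(B,A,M)$ then $\mathsf{Iterated}(P,\mathcal I,k)=P(B,A,(\Delta_{k-1},\omega_{k-1}))$; for $k>n+1$, $\mathsf{Iterated}(P,\mathcal I,k)=(\emptyset,\emptyset,\emptyset)$. *)

theory Defs
  imports "HOL-Library.Multiset"
begin

text \<open>An order is a tuple (id, timestamp, quantity, price).\<close>

typedef limit_order = "{(i :: nat, s :: nat, q :: nat, p :: nat). q > 0}"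
  by (rule exI[of _ "(0, 0, 1, 0)"]) simp

definition oid :: "limit_order \<Rightarrow> nat" where
  "oid w = (case Rep_limit_order w of (i, s, q, p) \<Rightarrow> i)"

definition timestamp :: "limit_order \<Rightarrow> nat" where
  "timestamp w = (case Rep_limit_order w of (i, s, q, p) \<Rightarrow> s)"

definition qty :: "limit_order \<Rightarrow> nat" where
  "qty w = (case Rep_limit_order w of (i, s, q, p) \<Rightarrow> q)"

definition price :: "limit_order \<Rightarrow> nat" where
  "price w = (case Rep_limit_order w of (i, s, q, p) \<Rightarrow> p)"

definition ids :: "limit_order set \<Rightarrow> nat set" where
  "ids S = oid ` S"

definition order_domain :: "limit_order set \<Rightarrow> limit_order set \<Rightarrow> bool" where
  "order_domain B A \<longleftrightarrow> finite B \<and> finite A"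

definition admissible :: "limit_order set \<Rightarrow> limit_order set \<Rightarrow> bool" where
  "admissible B A \<longleftrightarrow>
     order_domain B A \<and> inj_on oid (B \<union> A) \<and> inj_on timestamp (B \<union> A)"

definition tradable :: "limit_order \<Rightarrow> limit_order \<Rightarrow> bool" where
  "tradable b a \<longleftrightarrow> price b \<ge> price a"

definition matchable :: "limit_order set \<Rightarrow> limit_order set \<Rightarrow> bool" where
  "matchable B A \<longleftrightarrow> (\<exists>b\<in>B. \<exists>a\<in>A. tradable b a)"

definition bid_more_competitive :: "limit_order \<Rightarrow> limit_order \<Rightarrow> bool" where
  "bid_more_competitive b1 b2 \<longleftrightarrow>
     price b1 > price b2 \<or> price b1 = price b2 \<and> timestamp b1 < timestamp b2"

definition ask_more_competitive :: "limit_order \<Rightarrow> limit_order \<Rightarrow> bool" where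
  "ask_more_competitive a1 a2 \<longleftrightarrow>
     price a1 < price a2 \<or> price a1 = price a2 \<and> timestamp a1 < timestamp a2"

text \<open>A transaction is a triple (bid id, ask id, quantity).\<close>

typedef transaction = "{(i :: nat, j :: nat, q :: nat). q > 0}"
  by (rule exI[of _ "(0, 0, 1)"]) simp

definition id_bid :: "transaction \<Rightarrow> nat" where
  "id_bid t = (case Rep_transaction t of (i, j, q) \<Rightarrow> i)"

definition id_ask :: "transaction \<Rightarrow> nat" where
  "id_ask t = (case Rep_transaction t of (i, j, q) \<Rightarrow> j)"

definition tqty :: "transaction \<Rightarrow> nat" where
  "tqty t = (case Rep_transaction t of (i, j, q) \<Rightarrow> q)"

definition valid_transaction ::
    "limit_order set \<Rightarrow> limit_order set \<Rightarrow> transaction \<Rightarrow> bool" where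
  "valid_transaction B A t \<longleftrightarrow>
     (\<exists>b\<in>B. \<exists>a\<in>A. id_bid t = oid b \<and> id_ask t = oid a \<and> tradable b a \<and>
        tqty t \<le> min (qty b) (qty a))"

definition ids_bid :: "transaction set \<Rightarrow> nat set" where
  "ids_bid T = id_bid ` T"

definition ids_ask :: "transaction set \<Rightarrow> nat set" where
  "ids_ask T = id_ask ` T"

definition Qty_bid :: "transaction set \<Rightarrow> nat \<Rightarrow> nat" where
  "Qty_bid T i = (\<Sum>t\<in>{t \<in> T. id_bid t = i}. tqty t)"

definition Qty_ask :: "transaction set \<Rightarrow> nat \<Rightarrow> nat" where
  "Qty_ask T i = (\<Sum>t\<in>{t \<in> T. id_ask t = i}. tqty t)"

definition matching ::
    "limit_order set \<Rightarrow> limit_order set \<Rightarrow> transaction set \<Rightarrow> bool" where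
  "matching B A M \<longleftrightarrow>
     admissible B A \<and> finite M \<and> (\<forall>t\<in>M. valid_transaction B A t) \<and>
     (\<forall>b\<in>B. Qty_bid M (oid b) \<le> qty b) \<and>
     (\<forall>a\<in>A. Qty_ask M (oid a) \<le> qty a)"

text \<open>Transactions have positive quantity by construction, so pairs with total quantity 0
  contribute nothing.\<close>

definition canonical :: "transaction set \<Rightarrow> transaction set" where
  "canonical M =
     {t. tqty t = (\<Sum>t'\<in>{t' \<in> M. id_bid t' = id_bid t \<and> id_ask t' = id_ask t}. tqty t')}"

text \<open>An order with its quantity field suppressed.\<close>

definition order_key :: "limit_order \<Rightarrow> nat \<times> nat \<times> nat" where
  "order_key w = (oid w, timestamp w, price w)"

definition Bids :: "transaction set \<Rightarrow> limit_order set \<Rightarrow> limit_order set" where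
  "Bids M B =
     {w. \<exists>b\<in>B. oid b \<in> ids_bid M \<and> order_key w = order_key b \<and> qty w = Qty_bid M (oid b)}"

definition Asks :: "transaction set \<Rightarrow> limit_order set \<Rightarrow> limit_order set" where
  "Asks M A =
     {w. \<exists>a\<in>A. oid a \<in> ids_ask M \<and> order_key w = order_key a \<and> qty w = Qty_ask M (oid a)}"

text \<open>Sets of orders are identified with multisets of quantity-free orders: the multiplicity is
  the quantity. On the way back, each distinct element of the multiset gives exactly one order.\<close>

definition order_mset :: "limit_order set \<Rightarrow> (nat \<times> nat \<times> nat) multiset" where
  "order_mset S = (\<Sum>w\<in>S. replicate_mset (qty w) (order_key w))"

definition mset_orders :: "(nat \<times> nat \<times> nat) multiset \<Rightarrow> limit_order set" where
  "mset_orders X = {w. qty w = count X (order_key w)}"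

definition order_diff :: "limit_order set \<Rightarrow> limit_order set \<Rightarrow> limit_order set" where
  "order_diff S1 S2 = mset_orders (order_mset S1 - order_mset S2)"

datatype command = Buy | Sell | Del

type_synonym instruction = "command \<times> limit_order"

fun Absorb ::
    "limit_order set \<Rightarrow> limit_order set \<Rightarrow> instruction \<Rightarrow> limit_order set \<times> limit_order set" where
  "Absorb B A (Del, w) = ({b \<in> B. oid b \<noteq> oid w}, {a \<in> A. oid a \<noteq> oid w})"
| "Absorb B A (Buy, w) = (B \<union> {w}, A)"
| "Absorb B A (Sell, w) = (B, A \<union> {w})"

definition legal_input :: "limit_order set \<Rightarrow> limit_order set \<Rightarrow> instruction \<Rightarrow> bool" where
  "legal_input B A \<tau> \<longleftrightarrow>
     order_domain B A \<and> \<not> matchable B A \<and>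
     (case Absorb B A \<tau> of (B', A') \<Rightarrow> admissible B' A')"

type_synonym process =
  "limit_order set \<Rightarrow> limit_order set \<Rightarrow> instruction \<Rightarrow>
     limit_order set \<times> limit_order set \<times> transaction set"

definition positive_bid_ask_spread :: "process \<Rightarrow> bool" where
  "positive_bid_ask_spread P \<longleftrightarrow>
     (\<forall>B A \<tau> Bh Ah M. legal_input B A \<tau> \<and> P B A \<tau> = (Bh, Ah, M) \<longrightarrow> \<not> matchable Bh Ah)"

definition price_time_priority :: "process \<Rightarrow> bool" where
  "price_time_priority P \<longleftrightarrow>
     (\<forall>B A \<tau> Bh Ah M B' A'.
        legal_input B A \<tau> \<and> P B A \<tau> = (Bh, Ah, M) \<and> Absorb B A \<tau> = (B', A') \<longrightarrow>
        (\<forall>a\<in>A'. \<forall>a'\<in>A'. ask_more_competitive a a' \<and> oid a' \<in> ids_ask M \<longrightarrow>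
           Qty_ask M (oid a) = qty a) \<and>
        (\<forall>b\<in>B'. \<forall>b'\<in>B'. bid_more_competitive b b' \<and> oid b' \<in> ids_bid M \<longrightarrow>
           Qty_bid M (oid b) = qty b))"

definition conservation :: "process \<Rightarrow> bool" where
  "conservation P \<longleftrightarrow>
     (\<forall>B A \<tau> Bh Ah M B' A'.
        legal_input B A \<tau> \<and> P B A \<tau> = (Bh, Ah, M) \<and> Absorb B A \<tau> = (B', A') \<longrightarrow>
        matching B' A' M \<and>
        Bh = order_diff B' (Bids M B') \<and> Ah = order_diff A' (Asks M A'))"

type_synonym order_book = "instruction list"

definition structured :: "order_book \<Rightarrow> bool" where
  "structured I \<longleftrightarrow>
     (\<forall>i. Suc i < length I \<longrightarrow> timestamp (snd (I ! i)) < timestamp (snd (I ! Suc i))) \<and>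
     (\<forall>i<length I.
        fst (I ! i) = Del \<or>
        oid (snd (I ! i)) \<notin> ids {snd (I ! j) |j. j < i} \<or>
        i \<ge> 1 \<and> oid (snd (I ! i)) = oid (snd (I ! (i - 1))) \<and> fst (I ! (i - 1)) = Del)"

fun Iterated ::
    "process \<Rightarrow> order_book \<Rightarrow> nat \<Rightarrow> limit_order set \<times> limit_order set \<times> transaction set" where
  "Iterated P I 0 = ({}, {}, {})"
| "Iterated P I (Suc k) =
     (if k < length I then (case Iterated P I k of (B, A, M) \<Rightarrow> P B A (I ! k))
      else ({}, {}, {}))"

end

theory Submission
  imports Defs
begin

text \<open>As long as the resting book is not matchable, every trade caused by a new order \<open>\<omega>\<close> involves
  \<open>\<omega>\<close>. Hence the total traded between two orders, and so the canonical form, is determined by the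
  quantity filled on each opposite order. Suppose two matchings fill an opposite order \<open>a\<close>
  differently, the first one less. Then the first leaves a part of \<open>a\<close> unfilled, so by priority it
  trades nothing that is less competitive than \<open>a\<close>, while the second fills completely everything
  that is more competitive than \<open>a\<close>. So the first matching trades strictly less in total and leaves
  a part of \<open>\<omega>\<close> as well; \<open>\<omega>\<close> and \<open>a\<close> then remain tradable, against the positive spread.\<close>

section \<open>Orders and residual quantities\<close>

lemma qty_pos: "0 < qty w"
  using Rep_limit_order[of w] by (auto simp: qty_def)

lemma order_eqI: "order_key v = order_key w \<Longrightarrow> qty v = qty w \<Longrightarrow> v = w"
  by (auto simp: order_key_def oid_def timestamp_def price_def qty_def
      simp flip: Rep_limit_order_inject split: prod.splits)

lemma order_exists:
  assumes "0 < n"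
  obtains v where "order_key v = order_key w" "qty v = n"
proof
  let ?v = "Abs_limit_order (oid w, timestamp w, n, price w)"
  have "Rep_limit_order ?v = (oid w, timestamp w, n, price w)"
    using assms by (intro Abs_limit_order_inverse) auto
  then have fields: "oid ?v = oid w" "timestamp ?v = timestamp w" "price ?v = price w" "qty ?v = n"
    by (simp_all add: oid_def[of ?v] timestamp_def[of ?v] price_def[of ?v] qty_def[of ?v])
  show "order_key ?v = order_key w" and "qty ?v = n"
    by (simp_all add: order_key_def fields)
qed

text \<open>One form for the traded parts \<open>Bids\<close>, \<open>Asks\<close> and for what
  remains of a book. Since every order has positive quantity, a \<open>b\<close> with
  \<open>f b = 0\<close> leaves no trace.\<close>

definition requantify :: "(limit_order \<Rightarrow> nat) \<Rightarrow> limit_order set \<Rightarrow> limit_order set" where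
  "requantify f S = {w. \<exists>b\<in>S. order_key w = order_key b \<and> qty w = f b}"

lemma finite_requantify:
  assumes "finite S"
  shows "finite (requantify f S)"
proof (rule finite_imageD)
  show "finite ((\<lambda>w. (order_key w, qty w)) ` requantify f S)"
    by (rule finite_subset[of _ "(\<lambda>b. (order_key b, f b)) ` S"])
      (use assms in \<open>auto simp: requantify_def\<close>)
  show "inj_on (\<lambda>w. (order_key w, qty w)) (requantify f S)"
    by (auto intro!: inj_onI order_eqI)
qed

lemma inj_on_order_key: "inj_on oid S \<Longrightarrow> inj_on order_key S"
  by (auto simp: inj_on_def order_key_def)

lemma inj_on_oid_requantify: "inj_on oid S \<Longrightarrow> inj_on oid (requantify f S)"
  by (rule inj_onI, rule order_eqI)
    (auto simp: requantify_def order_key_def dest: inj_onD)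

lemma count_order_mset:
  assumes "finite S" and "inj_on oid S" and "w \<in> S"
  shows "count (order_mset S) (order_key w) = qty w"
proof -
  have eq: "order_key w = order_key v \<longleftrightarrow> v = w" if "v \<in> S" for v
    using inj_on_order_key[OF assms(2)] assms(3) that by (auto dest: inj_onD)
  have "count (order_mset S) (order_key w) = (\<Sum>v\<in>S. if v = w then qty v else 0)"
    unfolding order_mset_def count_sum by (intro sum.cong) (auto simp: eq)
  with assms show ?thesis by simp
qed

lemma count_order_mset_eq_0:
  assumes "k \<notin> order_key ` S"
  shows "count (order_mset S) k = 0"
  unfolding order_mset_def count_sum using assms by (intro sum.neutral) auto

lemma count_order_mset_requantify:
  assumes "finite S" and "inj_on oid S" and "b \<in> S"
  shows "count (order_mset (requantify f S)) (order_key b) = f b"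
proof (cases "f b = 0")
  case True
  \<comment> \<open>An order with the key of \<open>b\<close> could only come from \<open>b\<close>
    itself and would have quantity \<open>f b = 0\<close>.\<close>
  have "order_key b \<notin> order_key ` requantify f S"
  proof
    assume "order_key b \<in> order_key ` requantify f S"
    then obtain v c where "c \<in> S" "order_key c = order_key b" "qty v = f c"
      by (auto simp: requantify_def)
    moreover from this have "c = b"
      using inj_on_order_key[OF assms(2)] assms(3) by (auto dest: inj_onD)
    ultimately show False using True qty_pos[of v] by simp
  qed
  then show ?thesis using True by (simp add: count_order_mset_eq_0)
next
  case False
  then have "0 < f b" by simp
  then obtain v where v: "order_key v = order_key b" "qty v = f b"
    by (rule order_exists)
  then have "v \<in> requantify f S" using assms(3) by (auto simp: requantify_def)
  then show ?thesis
    using count_order_mset[OF finite_requantify[OF assms(1)] inj_on_oid_requantify[OF assms(2)]] v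
    by metis
qed

text \<open>Distinct ids give each key of \<open>S\<close> a single source, so multiset difference
  becomes truncated subtraction of quantities, order by order. This lets the later arguments work
  with quantities instead of multisets.\<close>

lemma order_diff_requantify:
  assumes "finite S" and "inj_on oid S"
  shows "order_diff S (requantify f S) = requantify (\<lambda>b. qty b - f b) S"
proof (intro set_eqI iffI)
  fix w assume "w \<in> order_diff S (requantify f S)"
  then have q: "qty w = count (order_mset S) (order_key w)
      - count (order_mset (requantify f S)) (order_key w)"
    by (simp add: order_diff_def mset_orders_def)
  then have "count (order_mset S) (order_key w) \<noteq> 0"
    using qty_pos[of w] by simp
  then have "order_key w \<in> order_key ` S" by (metis count_order_mset_eq_0)
  then obtain b where "b \<in> S" "order_key w = order_key b" by auto
  moreover from this q have "qty w = qty b - f b"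
    by (simp add: count_order_mset[OF assms] count_order_mset_requantify[OF assms])
  ultimately show "w \<in> requantify (\<lambda>b. qty b - f b) S"
    by (auto simp: requantify_def)
next
  fix w assume "w \<in> requantify (\<lambda>b. qty b - f b) S"
  then obtain b where "b \<in> S" "order_key w = order_key b" "qty w = qty b - f b"
    by (auto simp: requantify_def)
  then show "w \<in> order_diff S (requantify f S)"
    by (simp add: order_diff_def mset_orders_def count_order_mset[OF assms]
        count_order_mset_requantify[OF assms])
qed

lemma Qty_bid_eq_0: "i \<notin> ids_bid M \<Longrightarrow> Qty_bid M i = 0"
  by (auto simp: Qty_bid_def ids_bid_def intro!: sum.neutral)

lemma Qty_ask_eq_0: "i \<notin> ids_ask M \<Longrightarrow> Qty_ask M i = 0"
  by (auto simp: Qty_ask_def ids_ask_def intro!: sum.neutral)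

lemma Bids_eq_requantify: "Bids M B = requantify (\<lambda>b. Qty_bid M (oid b)) B"
proof -
  have "oid b \<in> ids_bid M" if "qty w = Qty_bid M (oid b)" for w b
    using that qty_pos[of w] Qty_bid_eq_0 by fastforce
  then show ?thesis by (auto simp: Bids_def requantify_def)
qed

lemma Asks_eq_requantify: "Asks M A = requantify (\<lambda>a. Qty_ask M (oid a)) A"
proof -
  have "oid a \<in> ids_ask M" if "qty w = Qty_ask M (oid a)" for w a
    using that qty_pos[of w] Qty_ask_eq_0 by fastforce
  then show ?thesis by (auto simp: Asks_def requantify_def)
qed

section \<open>Uniqueness of a priority fill\<close>

text \<open>The parameter \<open>g\<close> lets one argument serve both sides: \<open>id_bid\<close>
  yields \<open>Qty_bid\<close>, \<open>id_ask\<close> yields \<open>Qty_ask\<close>.\<close>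

definition filled :: "(transaction \<Rightarrow> nat) \<Rightarrow> transaction set \<Rightarrow> nat \<Rightarrow> nat" where
  "filled g M i = (\<Sum>t\<in>{t \<in> M. g t = i}. tqty t)"

text \<open>\<open>M\<close> matches a single order of quantity \<open>C\<close> against the orders of \<open>S\<close>, whose ids are read off
  from the transactions by \<open>g\<close>; \<open>better\<close> is the competitiveness relation of that side.\<close>

definition priority_fill ::
    "limit_order set \<Rightarrow> (limit_order \<Rightarrow> limit_order \<Rightarrow> bool) \<Rightarrow> nat \<Rightarrow> (transaction \<Rightarrow> nat) \<Rightarrow>
      transaction set \<Rightarrow> bool" where
  "priority_fill S better C g M \<longleftrightarrow>
     finite M \<and> g ` M \<subseteq> oid ` S \<and> (\<forall>a\<in>S. filled g M (oid a) \<le> qty a) \<and> sum tqty M \<le> C \<and>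
     (\<forall>a\<in>S. \<forall>a'\<in>S. better a a' \<and> oid a' \<in> g ` M \<longrightarrow> filled g M (oid a) = qty a) \<and>
     (\<forall>a\<in>S. filled g M (oid a) < qty a \<longrightarrow> C \<le> sum tqty M)"

lemma filled_eq_0: "i \<notin> g ` M \<Longrightarrow> filled g M i = 0"
  by (auto simp: filled_def intro!: sum.neutral)

lemma sum_filled:
  assumes "finite M" and "finite S" and "g ` M \<subseteq> oid ` S" and "inj_on oid S"
  shows "(\<Sum>a\<in>S. filled g M (oid a)) = sum tqty M"
proof -
  have "(\<Sum>a\<in>S. filled g M (oid a)) = (\<Sum>i\<in>oid ` S. filled g M i)"
    by (simp add: sum.reindex[OF assms(4)])
  also have "\<dots> = sum tqty M"
    unfolding filled_def using assms by (intro sum.group) auto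
  finally show ?thesis .
qed

lemma priority_fill_le:
  assumes M1: "priority_fill S better C g M1" and M2: "priority_fill S better C g M2"
    and fin: "finite S" and inj: "inj_on oid S"
    and total: "\<And>a a'. a \<in> S \<Longrightarrow> a' \<in> S \<Longrightarrow> a \<noteq> a' \<Longrightarrow> better a a' \<or> better a' a"
    and a: "a \<in> S"
  shows "filled g M2 (oid a) \<le> filled g M1 (oid a)"
proof (rule ccontr)
  assume "\<not> ?thesis"
  then have less: "filled g M1 (oid a) < filled g M2 (oid a)" by simp
  moreover have "filled g M2 (oid a) \<le> qty a" using M2 a by (simp add: priority_fill_def)
  ultimately have unfilled: "filled g M1 (oid a) < qty a" by simp
  have traded: "oid a \<in> g ` M2" using less filled_eq_0[of "oid a" g M2] by force
  \<comment> \<open>\<open>M2\<close> trades \<open>a\<close>, so it exhausts everything better than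
    \<open>a\<close>; \<open>M1\<close> leaves part of \<open>a\<close>, so it trades nothing worse.
    Hence \<open>M2\<close> dominates \<open>M1\<close> at every order.\<close>
  have le: "filled g M1 (oid c) \<le> filled g M2 (oid c)" if c: "c \<in> S" for c
  proof (cases "c = a")
    case True
    then show ?thesis using less by simp
  next
    case False
    then consider "better c a" | "better a c" using total a c by blast
    then show ?thesis
    proof cases
      case 1
      then have "filled g M2 (oid c) = qty c"
        using M2 a c traded unfolding priority_fill_def by blast
      then show ?thesis using M1 c by (simp add: priority_fill_def)
    next
      case 2
      then have "oid c \<notin> g ` M1"
        using M1 a c unfilled unfolding priority_fill_def by (metis less_irrefl)
      then show ?thesis by (simp add: filled_eq_0)
    qed
  qed
  have "(\<Sum>c\<in>S. filled g M1 (oid c)) < (\<Sum>c\<in>S. filled g M2 (oid c))"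
    by (rule sum_strict_mono_ex1) (use fin a less le in auto)
  then have "sum tqty M1 < sum tqty M2"
    using M1 M2 fin inj by (simp add: sum_filled priority_fill_def)
  \<comment> \<open>The unfilled part of \<open>a\<close> forces \<open>M1\<close> to use up all of
    \<open>C\<close>, leaving no room for the larger total of \<open>M2\<close>.\<close>
  moreover have "C \<le> sum tqty M1" "sum tqty M2 \<le> C"
    using M1 M2 a unfilled unfolding priority_fill_def by blast+
  ultimately show False by simp
qed

lemma priority_fill_unique:
  assumes "priority_fill S better C g M1" and "priority_fill S better C g M2"
    and "finite S" and "inj_on oid S"
    and "\<And>a a'. a \<in> S \<Longrightarrow> a' \<in> S \<Longrightarrow> a \<noteq> a' \<Longrightarrow> better a a' \<or> better a' a"
  shows "filled g M1 = filled g M2" and "sum tqty M1 = sum tqty M2"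
proof -
  have on_S: "filled g M1 (oid a) = filled g M2 (oid a)" if "a \<in> S" for a
    by (rule order_antisym; rule priority_fill_le[where S = S and better = better and C = C])
      (use assms that in blast)+
  have "filled g M1 i = filled g M2 i" for i
  proof (cases "i \<in> oid ` S")
    case True
    then show ?thesis using on_S by auto
  next
    case False
    then have "i \<notin> g ` M1" "i \<notin> g ` M2"
      using assms(1,2) by (auto simp: priority_fill_def)
    then show ?thesis by (simp add: filled_eq_0)
  qed
  then show "filled g M1 = filled g M2" by blast
  have "(\<Sum>a\<in>S. filled g M1 (oid a)) = (\<Sum>a\<in>S. filled g M2 (oid a))"
    using on_S by (intro sum.cong) auto
  then show "sum tqty M1 = sum tqty M2"
    using assms(1-4) by (simp add: sum_filled priority_fill_def)
qed

section \<open>Uniqueness of a single step\<close>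

definition pair_qty :: "transaction set \<Rightarrow> nat \<Rightarrow> nat \<Rightarrow> nat" where
  "pair_qty M i j = (\<Sum>t\<in>{t \<in> M. id_bid t = i \<and> id_ask t = j}. tqty t)"

text \<open>The canonical form depends on \<open>M\<close> only through its pair totals, so
  comparing these suffices.\<close>

lemma canonical_eq_pair_qty: "canonical M = {t. tqty t = pair_qty M (id_bid t) (id_ask t)}"
  by (simp add: canonical_def pair_qty_def)

definition residual_bids :: "transaction set \<Rightarrow> limit_order set \<Rightarrow> limit_order set" where
  "residual_bids M B = requantify (\<lambda>b. qty b - Qty_bid M (oid b)) B"

definition residual_asks :: "transaction set \<Rightarrow> limit_order set \<Rightarrow> limit_order set" where
  "residual_asks M A = requantify (\<lambda>a. qty a - Qty_ask M (oid a)) A"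

text \<open>What the three properties of a process say about one absorbed input, with the process
  itself eliminated. Uniqueness becomes a statement about matchings over a fixed
  order-domain.\<close>

definition fair_execution ::
    "limit_order set \<Rightarrow> limit_order set \<Rightarrow> transaction set \<Rightarrow> bool" where
  "fair_execution B A M \<longleftrightarrow>
     matching B A M \<and> \<not> matchable (residual_bids M B) (residual_asks M A) \<and>
     (\<forall>a\<in>A. \<forall>a'\<in>A. ask_more_competitive a a' \<and> oid a' \<in> ids_ask M \<longrightarrow>
        Qty_ask M (oid a) = qty a) \<and>
     (\<forall>b\<in>B. \<forall>b'\<in>B. bid_more_competitive b b' \<and> oid b' \<in> ids_bid M \<longrightarrow>
        Qty_bid M (oid b) = qty b)"

lemma fair_execution_process:
  assumes "positive_bid_ask_spread P" and "price_time_priority P" and "conservation P"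
    and legal: "legal_input B A \<tau>" and P: "P B A \<tau> = (Bh, Ah, M)" and abs: "Absorb B A \<tau> = (B', A')"
  shows "fair_execution B' A' M" and "Bh = residual_bids M B'" and "Ah = residual_asks M A'"
proof -
  have cons: "matching B' A' M" "Bh = order_diff B' (Bids M B')" "Ah = order_diff A' (Asks M A')"
    using assms(3) legal P abs unfolding conservation_def by blast+
  have "admissible B' A'" using cons(1) by (simp add: matching_def)
  then have "finite B'" "finite A'" "inj_on oid B'" "inj_on oid A'"
    by (auto simp: admissible_def order_domain_def intro: inj_on_subset)
  then show Bh: "Bh = residual_bids M B'" and Ah: "Ah = residual_asks M A'"
    by (simp_all add: cons(2,3) Bids_eq_requantify Asks_eq_requantify order_diff_requantify
        residual_bids_def residual_asks_def)
  have "\<not> matchable Bh Ah"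
    using assms(1) legal P unfolding positive_bid_ask_spread_def by blast
  moreover have
    "\<forall>a\<in>A'. \<forall>a'\<in>A'. ask_more_competitive a a' \<and> oid a' \<in> ids_ask M \<longrightarrow> Qty_ask M (oid a) = qty a"
    "\<forall>b\<in>B'. \<forall>b'\<in>B'. bid_more_competitive b b' \<and> oid b' \<in> ids_bid M \<longrightarrow> Qty_bid M (oid b) = qty b"
    using assms(2) legal P abs unfolding price_time_priority_def by blast+
  ultimately show "fair_execution B' A' M"
    unfolding fair_execution_def using cons(1) Bh Ah by simp
qed

text \<open>Two underfilled orders leave residues at their old prices, so tradability would survive
  into the residual book. This supplies the last clause of \<open>priority_fill\<close>.\<close>

lemma residual_pair_not_tradable:
  assumes "fair_execution B A M" and "b \<in> B" and "a \<in> A" and "tradable b a"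
    and "Qty_bid M (oid b) < qty b"
  shows "\<not> Qty_ask M (oid a) < qty a"
proof
  assume "Qty_ask M (oid a) < qty a"
  then have "0 < qty a - Qty_ask M (oid a)" by simp
  then obtain a' where a': "order_key a' = order_key a" "qty a' = qty a - Qty_ask M (oid a)"
    by (rule order_exists)
  have "0 < qty b - Qty_bid M (oid b)" using assms(5) by simp
  then obtain b' where b': "order_key b' = order_key b" "qty b' = qty b - Qty_bid M (oid b)"
    by (rule order_exists)
  have "b' \<in> residual_bids M B" "a' \<in> residual_asks M A"
    using a' b' assms(2,3) by (auto simp: residual_bids_def residual_asks_def requantify_def)
  moreover have "tradable b' a'"
    using assms(4) a'(1) b'(1) by (simp add: tradable_def order_key_def)
  ultimately show False using assms(1) by (auto simp: fair_execution_def matchable_def)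
qed

lemma matching_empty: "matching B A M \<Longrightarrow> \<not> matchable B A \<Longrightarrow> M = {}"
  by (auto simp: matching_def matchable_def valid_transaction_def)

text \<open>The case of an incoming bid \<open>\<beta>\<close>. Every transaction involves
  \<open>\<beta>\<close>, so all totals are read off from the quantities filled on the asks, and
  these form a priority fill.\<close>

lemma fair_execution_unique_bid:
  assumes M1: "fair_execution B A M1" and M2: "fair_execution B A M2"
    and \<beta>: "\<beta> \<in> B" "\<And>b a. b \<in> B \<Longrightarrow> a \<in> A \<Longrightarrow> tradable b a \<Longrightarrow> b = \<beta>"
  shows "Qty_bid M1 = Qty_bid M2" and "Qty_ask M1 = Qty_ask M2" and "pair_qty M1 = pair_qty M2"
proof -
  \<comment> \<open>Only asks tradable with \<open>\<beta>\<close> are kept: an unfilled ask outside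
    this set would say nothing about whether \<open>\<beta>\<close> is exhausted.\<close>
  define S where "S = {a \<in> A. tradable \<beta> a}"
  have adm: "admissible B A" using M1 by (simp add: fair_execution_def matching_def)
  have S: "finite S" "inj_on oid S" "inj_on timestamp S"
    using adm by (auto simp: S_def admissible_def order_domain_def intro: inj_on_subset)
  \<comment> \<open>Distinct timestamps break every tie in price.\<close>
  have total: "ask_more_competitive a a' \<or> ask_more_competitive a' a"
    if "a \<in> S" "a' \<in> S" "a \<noteq> a'" for a a'
  proof -
    have "timestamp a \<noteq> timestamp a'" using S(3) that by (auto dest: inj_onD)
    then show ?thesis by (auto simp: ask_more_competitive_def)
  qed
  have bid: "id_bid t = oid \<beta> \<and> id_ask t \<in> oid ` S" if "fair_execution B A M" "t \<in> M" for M t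
    using that \<beta>(2) by (fastforce simp: fair_execution_def matching_def valid_transaction_def S_def)
  have Qb: "Qty_bid M i = (if i = oid \<beta> then sum tqty M else 0)" if "fair_execution B A M" for M i
    unfolding Qty_bid_def using bid[OF that] by (auto intro!: sum.cong sum.neutral)
  have pq: "pair_qty M i j = (if i = oid \<beta> then Qty_ask M j else 0)"
    if "fair_execution B A M" for M i j
    unfolding pair_qty_def Qty_ask_def using bid[OF that] by (auto intro!: sum.cong sum.neutral)
  have Qa: "filled id_ask M = Qty_ask M" for M
    by (auto simp: filled_def Qty_ask_def)
  have fill: "priority_fill S ask_more_competitive (qty \<beta>) id_ask M"
    if M: "fair_execution B A M" for M
  proof -
    have m: "matching B A M" using M by (simp add: fair_execution_def)
    have "sum tqty M \<le> qty \<beta>"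
      using m \<beta>(1) Qb[OF M, of "oid \<beta>"] by (force simp: matching_def)
    moreover have "qty \<beta> \<le> sum tqty M" if "a \<in> S" "Qty_ask M (oid a) < qty a" for a
    proof -
      have "a \<in> A" "tradable \<beta> a" using that(1) by (simp_all add: S_def)
      then have "\<not> Qty_bid M (oid \<beta>) < qty \<beta>"
        using residual_pair_not_tradable[OF M \<beta>(1)] that(2) by blast
      then show ?thesis by (simp add: Qb[OF M])
    qed
    moreover have "Qty_ask M (oid a) = qty a"
      if "a \<in> S" "a' \<in> S" "ask_more_competitive a a'" "oid a' \<in> id_ask ` M" for a a'
      using M that unfolding fair_execution_def S_def ids_ask_def by blast
    moreover have "finite M" "id_ask ` M \<subseteq> oid ` S" "\<forall>a\<in>S. Qty_ask M (oid a) \<le> qty a"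
      using m bid[OF M] by (auto simp: matching_def S_def)
    ultimately show ?thesis by (auto simp: priority_fill_def Qa)
  qed
  note unique = priority_fill_unique[OF fill[OF M1] fill[OF M2] S(1,2) total]
  then show "Qty_ask M1 = Qty_ask M2" and "Qty_bid M1 = Qty_bid M2" and "pair_qty M1 = pair_qty M2"
    by (simp_all add: fun_eq_iff Qa Qb[OF M1] Qb[OF M2] pq[OF M1] pq[OF M2])
qed

text \<open>The mirror image of \<open>fair_execution_unique_bid\<close>, for an incoming ask
  \<open>\<alpha>\<close> filled from the bids.\<close>

lemma fair_execution_unique_ask:
  assumes M1: "fair_execution B A M1" and M2: "fair_execution B A M2"
    and \<alpha>: "\<alpha> \<in> A" "\<And>b a. b \<in> B \<Longrightarrow> a \<in> A \<Longrightarrow> tradable b a \<Longrightarrow> a = \<alpha>"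
  shows "Qty_bid M1 = Qty_bid M2" and "Qty_ask M1 = Qty_ask M2" and "pair_qty M1 = pair_qty M2"
proof -
  define S where "S = {b \<in> B. tradable b \<alpha>}"
  have adm: "admissible B A" using M1 by (simp add: fair_execution_def matching_def)
  have S: "finite S" "inj_on oid S" "inj_on timestamp S"
    using adm by (auto simp: S_def admissible_def order_domain_def intro: inj_on_subset)
  have total: "bid_more_competitive b b' \<or> bid_more_competitive b' b"
    if "b \<in> S" "b' \<in> S" "b \<noteq> b'" for b b'
  proof -
    have "timestamp b \<noteq> timestamp b'" using S(3) that by (auto dest: inj_onD)
    then show ?thesis by (auto simp: bid_more_competitive_def)
  qed
  have ask: "id_ask t = oid \<alpha> \<and> id_bid t \<in> oid ` S" if "fair_execution B A M" "t \<in> M" for M t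
    using that \<alpha>(2) by (fastforce simp: fair_execution_def matching_def valid_transaction_def S_def)
  have Qa: "Qty_ask M i = (if i = oid \<alpha> then sum tqty M else 0)" if "fair_execution B A M" for M i
    unfolding Qty_ask_def using ask[OF that] by (auto intro!: sum.cong sum.neutral)
  have pq: "pair_qty M i j = (if j = oid \<alpha> then Qty_bid M i else 0)"
    if "fair_execution B A M" for M i j
    unfolding pair_qty_def Qty_bid_def using ask[OF that] by (auto intro!: sum.cong sum.neutral)
  have Qb: "filled id_bid M = Qty_bid M" for M
    by (auto simp: filled_def Qty_bid_def)
  have fill: "priority_fill S bid_more_competitive (qty \<alpha>) id_bid M"
    if M: "fair_execution B A M" for M
  proof -
    have m: "matching B A M" using M by (simp add: fair_execution_def)
    have "sum tqty M \<le> qty \<alpha>"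
      using m \<alpha>(1) Qa[OF M, of "oid \<alpha>"] by (force simp: matching_def)
    moreover have "qty \<alpha> \<le> sum tqty M" if "b \<in> S" "Qty_bid M (oid b) < qty b" for b
    proof -
      have "b \<in> B" "tradable b \<alpha>" using that(1) by (simp_all add: S_def)
      then have "\<not> Qty_ask M (oid \<alpha>) < qty \<alpha>"
        using residual_pair_not_tradable[OF M _ \<alpha>(1)] that(2) by blast
      then show ?thesis by (simp add: Qa[OF M])
    qed
    moreover have "Qty_bid M (oid b) = qty b"
      if "b \<in> S" "b' \<in> S" "bid_more_competitive b b'" "oid b' \<in> id_bid ` M" for b b'
      using M that unfolding fair_execution_def S_def ids_bid_def by blast
    moreover have "finite M" "id_bid ` M \<subseteq> oid ` S" "\<forall>b\<in>S. Qty_bid M (oid b) \<le> qty b"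
      using m ask[OF M] by (auto simp: matching_def S_def)
    ultimately show ?thesis by (auto simp: priority_fill_def Qb)
  qed
  note unique = priority_fill_unique[OF fill[OF M1] fill[OF M2] S(1,2) total]
  then show "Qty_bid M1 = Qty_bid M2" and "Qty_ask M1 = Qty_ask M2" and "pair_qty M1 = pair_qty M2"
    by (simp_all add: fun_eq_iff Qb Qa[OF M1] Qa[OF M2] pq[OF M1] pq[OF M2])
qed

text \<open>The resting book has no tradable pair, so any pair tradable after absorption contains
  the new order. A deletion creates none, and then both matchings are empty.\<close>

lemma fair_execution_unique:
  assumes M1: "fair_execution B' A' M1" and M2: "fair_execution B' A' M2"
    and nm: "\<not> matchable B A" and abs: "Absorb B A (c, w) = (B', A')"
  shows "residual_bids M1 B' = residual_bids M2 B'" and "residual_asks M1 A' = residual_asks M2 A'"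
    and "canonical M1 = canonical M2"
proof -
  have "Qty_bid M1 = Qty_bid M2 \<and> Qty_ask M1 = Qty_ask M2 \<and> pair_qty M1 = pair_qty M2"
  proof (cases c)
    case Buy
    then have "w \<in> B'" "\<And>b a. b \<in> B' \<Longrightarrow> a \<in> A' \<Longrightarrow> tradable b a \<Longrightarrow> b = w"
      using abs nm by (auto simp: matchable_def)
    then show ?thesis using fair_execution_unique_bid[OF M1 M2] by blast
  next
    case Sell
    then have "w \<in> A'" "\<And>b a. b \<in> B' \<Longrightarrow> a \<in> A' \<Longrightarrow> tradable b a \<Longrightarrow> a = w"
      using abs nm by (auto simp: matchable_def)
    then show ?thesis using fair_execution_unique_ask[OF M1 M2] by blast
  next
    case Del
    then have "\<not> matchable B' A'" using abs nm by (auto simp: matchable_def)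
    then have "M1 = {}" "M2 = {}"
      using M1 M2 matching_empty by (auto simp: fair_execution_def)
    then show ?thesis by simp
  qed
  then show "residual_bids M1 B' = residual_bids M2 B'"
    and "residual_asks M1 A' = residual_asks M2 A'" and "canonical M1 = canonical M2"
    by (simp_all add: residual_bids_def residual_asks_def canonical_eq_pair_qty)
qed

section \<open>Legality of the inputs along a structured order book\<close>

text \<open>The invariant of the book just before instruction \<open>k\<close>. Its third clause
  traces resting orders back to earlier instructions; the last one allows an id to be reused right
  after its deletion.\<close>

definition sound_book ::
    "order_book \<Rightarrow> nat \<Rightarrow> limit_order set \<Rightarrow> limit_order set \<Rightarrow> bool" where
  "sound_book I k B A \<longleftrightarrow>
     admissible B A \<and> \<not> matchable B A \<and>
     (\<forall>w\<in>B \<union> A. \<exists>j<k. oid w = oid (snd (I ! j)) \<and> timestamp w = timestamp (snd (I ! j))) \<and>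
     (0 < k \<and> fst (I ! (k - 1)) = Del \<longrightarrow> oid (snd (I ! (k - 1))) \<notin> ids (B \<union> A))"

lemma structured_timestamp_less:
  assumes "structured I" and "i < j" and "j < length I"
  shows "timestamp (snd (I ! i)) < timestamp (snd (I ! j))"
  using assms(2,3)
proof (induction j)
  case (Suc j)
  have "timestamp (snd (I ! j)) < timestamp (snd (I ! Suc j))"
    using assms(1) Suc.prems by (simp add: structured_def)
  with Suc show ?case by (cases "i = j") auto
qed simp

text \<open>Only insertions can endanger admissibility. The new timestamp exceeds all earlier ones;
  the new id either has never occurred or was deleted by the previous instruction and is therefore
  absent from the book.\<close>

lemma sound_book_legal_input:
  assumes "structured I" and k: "k < length I" and s: "sound_book I k B A"
  shows "legal_input B A (I ! k)"
proof -
  obtain c w where cw: "I ! k = (c, w)" by force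
  have adm: "finite B" "finite A" "inj_on oid (B \<union> A)" "inj_on timestamp (B \<union> A)"
    and nm: "\<not> matchable B A"
    using s by (auto simp: sound_book_def admissible_def order_domain_def)
  have "case Absorb B A (c, w) of (B', A') \<Rightarrow> admissible B' A'"
  proof (cases "c = Del")
    case True
    then show ?thesis
      using adm by (auto simp: admissible_def order_domain_def intro: inj_on_subset)
  next
    case False
    have "fst (I ! k) = Del \<or> oid (snd (I ! k)) \<notin> ids {snd (I ! j) |j. j < k} \<or>
        k \<ge> 1 \<and> oid (snd (I ! k)) = oid (snd (I ! (k - 1))) \<and> fst (I ! (k - 1)) = Del"
      using assms(1) k unfolding structured_def by blast
    with False have fresh: "oid w \<notin> ids {snd (I ! j) |j. j < k} \<or>
        k \<ge> 1 \<and> oid w = oid (snd (I ! (k - 1))) \<and> fst (I ! (k - 1)) = Del"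
      by (simp only: cw fst_conv snd_conv simp_thms)
    have seen: "\<exists>j<k. oid v = oid (snd (I ! j)) \<and> timestamp v = timestamp (snd (I ! j))"
      if "v \<in> B \<union> A" for v
      using s that unfolding sound_book_def by blast
    have id: "oid w \<notin> oid ` (B \<union> A)"
      using fresh
    proof
      assume new: "oid w \<notin> ids {snd (I ! j) |j. j < k}"
      show ?thesis
      proof
        assume "oid w \<in> oid ` (B \<union> A)"
        then obtain j where "j < k" "oid w = oid (snd (I ! j))" using seen by fastforce
        then show False using new by (auto simp: ids_def)
      qed
    next
      assume "k \<ge> 1 \<and> oid w = oid (snd (I ! (k - 1))) \<and> fst (I ! (k - 1)) = Del"
      then show ?thesis using s by (auto simp: sound_book_def ids_def)
    qed
    have ts: "timestamp w \<notin> timestamp ` (B \<union> A)"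
    proof
      assume "timestamp w \<in> timestamp ` (B \<union> A)"
      then obtain j where "j < k" "timestamp w = timestamp (snd (I ! j))" using seen by fastforce
      then show False using structured_timestamp_less[OF assms(1) _ k, of j] cw by simp
    qed
    \<comment> \<open>For \<open>Buy\<close> and \<open>Sell\<close> alike, this is the union of the
      two sides after absorption.\<close>
    have "inj_on oid (insert w (B \<union> A))" "inj_on timestamp (insert w (B \<union> A))"
      using adm id ts by (auto simp: inj_on_insert)
    then show ?thesis using False adm
      by (cases c) (auto simp: admissible_def order_domain_def)
  qed
  then show ?thesis using adm nm cw by (simp add: legal_input_def order_domain_def)
qed

text \<open>Since \<open>admissible\<close> does not force the two sides to be disjoint, an order could leave a residue
  on each side; those residues would be tradable with each other.\<close>

lemma residual_unique:
  assumes "fair_execution B A M"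
    and v: "v \<in> residual_bids M B \<union> residual_asks M A"
    and w: "w \<in> residual_bids M B \<union> residual_asks M A"
    and eq: "oid v = oid w \<or> timestamp v = timestamp w"
  shows "v = w"
proof -
  have adm: "inj_on oid (B \<union> A)" "inj_on timestamp (B \<union> A)"
    using assms(1) by (auto simp: fair_execution_def matching_def admissible_def)
  have same: "b = a"
    if "b \<in> B \<union> A" "a \<in> B \<union> A" "order_key v = order_key b" "order_key w = order_key a" for a b
    using that eq adm by (auto simp: order_key_def dest: inj_onD)
  have "\<exists>b\<in>B \<union> A. order_key v = order_key b" "\<exists>a\<in>B \<union> A. order_key w = order_key a"
    using v w by (auto simp: residual_bids_def residual_asks_def requantify_def)
  then have "order_key v = order_key w" using same by metis
  then have "tradable v w" "tradable w v" by (simp_all add: order_key_def tradable_def)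
  then have "v \<in> residual_bids M B \<and> w \<in> residual_bids M B \<or>
      v \<in> residual_asks M A \<and> w \<in> residual_asks M A"
    using v w assms(1) unfolding fair_execution_def matchable_def by blast
  \<comment> \<open>On a common side one function \<open>f\<close> determines both residual
    quantities, so a common source makes them equal.\<close>
  then obtain S f where S: "S \<subseteq> B \<union> A" "v \<in> requantify f S" "w \<in> requantify f S"
    unfolding residual_bids_def residual_asks_def by blast
  then obtain b a where ba: "b \<in> S" "order_key v = order_key b" "qty v = f b"
      "a \<in> S" "order_key w = order_key a" "qty w = f a"
    unfolding requantify_def by blast
  then have "b = a" using S(1) by (intro same) auto
  with ba have "qty v = qty w" by simp
  with \<open>order_key v = order_key w\<close> show ?thesis by (rule order_eqI)
qed

text \<open>Residues keep the id and timestamp of their source, which is a resting order or the one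
  just inserted. \<open>residual_unique\<close> turns this into admissibility.\<close>

lemma sound_book_step:
  assumes s: "sound_book I k B A" and abs: "Absorb B A (I ! k) = (B', A')"
    and M: "fair_execution B' A' M"
  shows "sound_book I (Suc k) (residual_bids M B') (residual_asks M A')"
proof -
  let ?R = "residual_bids M B' \<union> residual_asks M A'"
  obtain c w where cw: "I ! k = (c, w)" by force
  have origin: "\<exists>u\<in>B' \<union> A'. oid v = oid u \<and> timestamp v = timestamp u" if "v \<in> ?R" for v
    using that by (auto simp: residual_bids_def residual_asks_def requantify_def order_key_def)
  have "finite B'" "finite A'"
    using M by (auto simp: fair_execution_def matching_def admissible_def order_domain_def)
  then have "order_domain (residual_bids M B') (residual_asks M A')"
    by (simp add: order_domain_def residual_bids_def residual_asks_def finite_requantify)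
  then have adm: "admissible (residual_bids M B') (residual_asks M A')"
    using residual_unique[OF M] unfolding admissible_def inj_on_def by blast
  have seen: "\<exists>j<Suc k. oid u = oid (snd (I ! j)) \<and> timestamp u = timestamp (snd (I ! j))"
    if u: "u \<in> B' \<union> A'" for u
  proof -
    have "u \<in> B \<union> A \<or> u = w" using u abs cw by (cases c) auto
    then show ?thesis
    proof
      assume "u \<in> B \<union> A"
      then show ?thesis using s unfolding sound_book_def by (meson less_SucI)
    next
      assume "u = w"
      then show ?thesis using cw by (intro exI[of _ k]) simp
    qed
  qed
  \<comment> \<open>At \<open>Suc k\<close> the deletion clause of \<open>sound_book\<close> refers
    to instruction \<open>k\<close>, the one just executed.\<close>
  have "oid w \<notin> oid ` ?R" if "c = Del"
  proof -
    have "oid w \<notin> oid ` (B' \<union> A')" using that abs cw by auto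
    then show ?thesis using origin by fastforce
  qed
  moreover have "\<exists>j<Suc k. oid v = oid (snd (I ! j)) \<and> timestamp v = timestamp (snd (I ! j))"
    if "v \<in> ?R" for v
    using origin[OF that] seen by metis
  moreover have "\<not> matchable (residual_bids M B') (residual_asks M A')"
    using M by (simp add: fair_execution_def)
  ultimately show ?thesis
    unfolding sound_book_def ids_def using adm cw by simp
qed

section \<open>Uniqueness of the iterated process\<close>

text \<open>The two matchings agree only in canonical form, but the next step reads just the book,
  which is literally the same for both. The invariant is carried along to keep every input
  legal.\<close>

lemma Iterated_unique:
  assumes P1: "positive_bid_ask_spread P1" "price_time_priority P1" "conservation P1"
    and P2: "positive_bid_ask_spread P2" "price_time_priority P2" "conservation P2"
    and I: "structured I" and k: "k \<le> length I"
  shows "\<exists>B A M1 M2. Iterated P1 I k = (B, A, M1) \<and> Iterated P2 I k = (B, A, M2) \<and>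
    canonical M1 = canonical M2 \<and> sound_book I k B A"
  using k
proof (induction k)
  case 0
  show ?case
    by (simp add: sound_book_def admissible_def order_domain_def matchable_def)
next
  case (Suc k)
  then obtain B A M1 M2 where it: "Iterated P1 I k = (B, A, M1)" "Iterated P2 I k = (B, A, M2)"
    and s: "sound_book I k B A"
    by auto
  from Suc.prems have k: "k < length I" by simp
  obtain B1 A1 N1 where R1: "P1 B A (I ! k) = (B1, A1, N1)" by (metis prod_cases3)
  obtain B2 A2 N2 where R2: "P2 B A (I ! k) = (B2, A2, N2)" by (metis prod_cases3)
  obtain B' A' where abs: "Absorb B A (I ! k) = (B', A')" by force
  have legal: "legal_input B A (I ! k)" by (rule sound_book_legal_input[OF I k s])
  note ex1 = fair_execution_process[OF P1 legal R1 abs]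
  note ex2 = fair_execution_process[OF P2 legal R2 abs]
  have nm: "\<not> matchable B A" using s by (simp add: sound_book_def)
  obtain c w where cw: "I ! k = (c, w)" by force
  note unique = fair_execution_unique[OF ex1(1) ex2(1) nm abs[unfolded cw]]
  have "Iterated P1 I (Suc k) = (B1, A1, N1)" "Iterated P2 I (Suc k) = (B1, A1, N2)"
    using it R1 R2 k unique ex1 ex2 by simp_all
  moreover have "sound_book I (Suc k) B1 A1"
    using sound_book_step[OF s abs ex1(1)] ex1(2,3) by simp
  ultimately show ?case using unique(3) by blast
qed

theorem theorem2:
  fixes P1 P2 :: process and I :: order_book and k :: nat
    and B1 A1 B2 A2 :: "limit_order set" and M1 M2 :: "transaction set"
  assumes "positive_bid_ask_spread P1" and "price_time_priority P1" and "conservation P1"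
    and "positive_bid_ask_spread P2" and "price_time_priority P2" and "conservation P2"
    and "structured I"
    and "Iterated P1 I k = (B1, A1, M1)"
    and "Iterated P2 I k = (B2, A2, M2)"
  shows "(B1, A1, canonical M1) = (B2, A2, canonical M2)"
proof (cases "k \<le> length I")
  case True
  then show ?thesis using Iterated_unique[OF assms(1-7) True] assms(8,9) by auto
next
  case False
  \<comment> \<open>Past the end of the order book both iterations return the default triple of
    empty sets.\<close>
  then obtain j where "k = Suc j" "\<not> j < length I" by (cases k) auto
  then show ?thesis using assms(8,9) by simp
qed

end
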